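(* Let $M=(m_{ij})\in\mathbb{R}^{n\times m}$ be the matrix of a joint distribution of two discrete random variables $X$ and $Y$, i.e. $m_{ij}=\Pr[X=x_i,Y=y_j]\ge 0$ and $\sum_{i,j}m_{ij}=1$. Then \[2^{I(X:Y)}\le \operatorname{rank} M,\] where $I(X:Y)$ is the mutual information of $X$ and $Y$.
   Context: Let $p_i=\sum_{j=1}^m m_{ij}$ and $q_j=\sum_{i=1}^n m_{ij}$ be the marginal probabilities. The mutual information is $I(X:Y)=\sum_{i=1}^n\sum_{j=1}^m m_{ij}\log_2\frac{m_{ij}}{p_iq_j}$, with the convention $0\log\frac{0}{q}=0$. $\operatorname{rank}M$ denotes the usual (real) rank of $M$. *)

theory Defs
  imports "HOL-Analysis.Analysis"
begin

text \<open>
  A matrix \<open>M :: real^'m^'n\<close> has \<open>n\<close> rows (values of \<open>X\<close>) and \<open>m\<close> columns (values of \<open>Y\<close>);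
  \<open>M $ i $ j\<close> is \<open>Pr[X = x\<^sub>i, Y = y\<^sub>j]\<close>.
\<close>

definition joint_distribution :: "real^'m^'n \<Rightarrow> bool" where
  "joint_distribution M \<longleftrightarrow>
     (\<forall>i j. 0 \<le> M $ i $ j) \<and> (\<Sum>i\<in>UNIV. \<Sum>j\<in>UNIV. M $ i $ j) = 1"

definition row_marginal :: "real^'m^'n \<Rightarrow> 'n \<Rightarrow> real" where
  "row_marginal M i = (\<Sum>j\<in>UNIV. M $ i $ j)"

definition col_marginal :: "real^'m^'n \<Rightarrow> 'm \<Rightarrow> real" where
  "col_marginal M j = (\<Sum>i\<in>UNIV. M $ i $ j)"

text \<open>
  The convention \<open>0 log (0/q) = 0\<close> (also for \<open>q = 0\<close>) needs no case distinction: the factor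
  \<open>M $ i $ j = 0\<close> makes the summand \<open>0\<close>. For a joint distribution, \<open>M $ i $ j > 0\<close> implies that
  both marginals are positive, so no other summand relies on a totalised division or logarithm.
\<close>

definition mutual_info :: "real^'m^'n \<Rightarrow> real" where
  "mutual_info M =
     (\<Sum>i\<in>UNIV. \<Sum>j\<in>UNIV.
        M $ i $ j * log 2 (M $ i $ j / (row_marginal M i * col_marginal M j)))"

end

theory Submission
  imports Defs
begin

text \<open>
  By Jensen's inequality for the logarithm, \<open>2 powr I\<close> is at most
  \<open>\<Sum> (M $ i $ j)\<^sup>2 / (p\<^sub>i q\<^sub>j)\<close>, the squared Frobenius norm of the matrix \<open>N\<close> with entries
  \<open>M $ i $ j / sqrt (p\<^sub>i q\<^sub>j)\<close>. The Cauchy-Schwarz inequality shows that \<open>N\<close> is a contraction, and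
  the squared Frobenius norm of a contraction is at most its rank, as one sees by expanding its
  columns in an orthonormal basis of the column space. Finally, \<open>N\<close> arises from \<open>M\<close> by scaling rows
  and columns, so \<open>rank N \<le> rank M\<close>.
\<close>

lemma orthonormal_basis_Parseval:
  fixes B :: "'a::euclidean_space set"
  assumes orth: "pairwise orthogonal B" and unit: "\<And>b. b \<in> B \<Longrightarrow> norm b = 1"
    and "independent B" and x: "x \<in> span B"
  shows "(norm x)\<^sup>2 = (\<Sum>b\<in>B. (b \<bullet> x)\<^sup>2)"
proof -
  have "(norm x)\<^sup>2 = x \<bullet> (\<Sum>b\<in>B. (x \<bullet> b) *\<^sub>R b)"
    using orthonormal_basis_expand[OF orth unit x independent_imp_finite] \<open>independent B\<close>
    by (simp add: power2_norm_eq_inner)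
  then show ?thesis
    by (simp add: inner_sum_right power2_eq_square inner_commute)
qed

lemma power2_norm_vec:
  fixes x :: "real^'n"
  shows "(norm x)\<^sup>2 = (\<Sum>i\<in>UNIV. (x $ i)\<^sup>2)"
  unfolding power2_norm_eq_inner inner_vec_def by (simp add: power2_eq_square)

text \<open>By Parseval in an orthonormal basis \<open>B\<close> of the column space, exchanging the
  sums over columns and over \<open>B\<close> turns the left side into the sum of
  \<open>(norm (transpose A *v b))\<^sup>2\<close> over \<open>b\<close> in \<open>B\<close>. Each
  term is at most 1, and \<open>B\<close> has \<open>rank A\<close> elements.\<close>

lemma contraction_sum_squares_le_rank:
  fixes A :: "real^'m^'n"
  assumes contraction: "\<And>u. norm (transpose A *v u) \<le> norm u"
  shows "(\<Sum>i\<in>UNIV. \<Sum>j\<in>UNIV. (A $ i $ j)\<^sup>2) \<le> real (rank A)"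
proof -
  obtain B where B: "pairwise orthogonal B" "\<And>b. b \<in> B \<Longrightarrow> norm b = 1" "independent B"
      "card B = dim (span (columns A))" "span B = span (columns A)"
    using orthonormal_basis_subspace[OF subspace_span[of "columns A"]] by metis
  have col: "column j A \<in> span B" for j
    unfolding B(5) by (rule span_base) (auto simp: columns_def)
  have norm_col: "(norm (column j A))\<^sup>2 = (\<Sum>i\<in>UNIV. (A $ i $ j)\<^sup>2)" for j
    by (simp add: power2_norm_vec column_def)
  have inner_col: "b \<bullet> column j A = (transpose A *v b) $ j" for b j
    by (simp add: inner_vec_def column_def transpose_def matrix_vector_mult_def mult.commute)
  have "(\<Sum>i\<in>UNIV. \<Sum>j\<in>UNIV. (A $ i $ j)\<^sup>2) = (\<Sum>j\<in>UNIV. (norm (column j A))\<^sup>2)"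
    unfolding norm_col by (rule sum.swap)
  also have "\<dots> = (\<Sum>j\<in>UNIV. \<Sum>b\<in>B. (b \<bullet> column j A)\<^sup>2)"
    using orthonormal_basis_Parseval[OF B(1-3) col] by simp
  also have "\<dots> = (\<Sum>b\<in>B. (norm (transpose A *v b))\<^sup>2)"
    unfolding inner_col
    by (subst sum.swap) (simp add: power2_norm_vec)
  also have "\<dots> \<le> (\<Sum>b\<in>B. 1)"
  proof (rule sum_mono)
    fix b assume "b \<in> B"
    then have "norm (transpose A *v b) \<le> 1"
      using contraction[of b] B(2) by simp
    then show "(norm (transpose A *v b))\<^sup>2 \<le> 1"
      by (simp add: power_le_one)
  qed
  also have "\<dots> = real (rank A)"
    using B(4) by (simp add: column_rank_def dim_span)
  finally show ?thesis .
qed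

text \<open>The scaling is multiplication by diagonal matrices on both sides, which cannot increase
  the rank; factors may be 0, hence only an inequality.\<close>

lemma rank_scale_rows_columns_le:
  fixes A :: "real^'m^'n"
  shows "rank (\<chi> i j. r i * A $ i $ j * c j) \<le> rank A"
proof -
  let ?R = "(\<chi> i j. if i = j then r i else 0) :: real^'n^'n"
  let ?C = "(\<chi> i j. if i = j then c j else 0) :: real^'m^'m"
  have "(\<chi> i j. r i * A $ i $ j * c j) = ?R ** A ** ?C"
    by (simp add: vec_eq_iff matrix_matrix_mult_def if_distrib if_distribR cong: if_cong)
  then show ?thesis
    using rank_mul_le_left[of "?R ** A" ?C] rank_mul_le_right[of ?R A] by simp
qed

context
  fixes M :: "real^'m^'n"
  assumes joint: "joint_distribution M"
begin

lemma entry_nonneg: "0 \<le> M $ i $ j"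
  using joint by (simp add: joint_distribution_def)

lemma sum_entries: "(\<Sum>i\<in>UNIV. \<Sum>j\<in>UNIV. M $ i $ j) = 1"
  using joint by (simp add: joint_distribution_def)

lemma entry_le_row_marginal: "M $ i $ j \<le> row_marginal M i"
  unfolding row_marginal_def by (rule member_le_sum) (auto simp: entry_nonneg)

lemma entry_le_col_marginal: "M $ i $ j \<le> col_marginal M j"
  unfolding col_marginal_def by (rule member_le_sum[where f = "\<lambda>i. M $ i $ j"]) (auto simp: entry_nonneg)

lemma row_marginal_nonneg: "0 \<le> row_marginal M i"
  by (simp add: row_marginal_def sum_nonneg entry_nonneg)

lemma col_marginal_nonneg: "0 \<le> col_marginal M j"
  by (simp add: col_marginal_def sum_nonneg entry_nonneg)

text \<open>If a marginal is 0, its factor \<open>1 / sqrt 0\<close> is 0 in HOL; this is harmless,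
  since the corresponding row or column of \<open>M\<close> vanishes.\<close>

definition normalized :: "real^'m^'n" where
  "normalized = (\<chi> i j. (1 / sqrt (row_marginal M i)) * M $ i $ j * (1 / sqrt (col_marginal M j)))"

lemma normalized_contraction: "norm (transpose normalized *v u) \<le> norm u"
proof -
  let ?p = "row_marginal M" and ?q = "col_marginal M"
  have bound: "((transpose normalized *v u) $ j)\<^sup>2 \<le> (\<Sum>i\<in>UNIV. M $ i $ j * (u $ i)\<^sup>2 / ?p i)" for j
  proof -
    \<comment> \<open>Splitting each entry evenly makes the squares of the first factors add up to
      the total of column \<open>j\<close> of \<open>M\<close> divided by
      \<open>?q j\<close>.\<close>
    have "(transpose normalized *v u) $ j =
        (\<Sum>i\<in>UNIV. sqrt (M $ i $ j / ?q j) * (sqrt (M $ i $ j / ?p i) * u $ i))"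
      unfolding matrix_vector_mult_def vec_lambda_beta
    proof (rule sum.cong)
      fix i
      have "M $ i $ j = sqrt (M $ i $ j) * sqrt (M $ i $ j)"
        by (simp add: entry_nonneg)
      then show "transpose normalized $ j $ i * u $ i =
          sqrt (M $ i $ j / ?q j) * (sqrt (M $ i $ j / ?p i) * u $ i)"
        by (simp add: transpose_def normalized_def real_sqrt_divide ac_simps)
    qed simp
    then have "((transpose normalized *v u) $ j)\<^sup>2 \<le>
        (\<Sum>i\<in>UNIV. (sqrt (M $ i $ j / ?q j))\<^sup>2) *
        (\<Sum>i\<in>UNIV. (sqrt (M $ i $ j / ?p i) * u $ i)\<^sup>2)"
      by (simp only: Cauchy_Schwarz_ineq_sum)
    also have "(\<Sum>i\<in>UNIV. (sqrt (M $ i $ j / ?q j))\<^sup>2) = ?q j / ?q j"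
      by (simp add: entry_nonneg col_marginal_nonneg sum_divide_distrib[symmetric])
        (simp add: col_marginal_def)
    also have "(\<Sum>i\<in>UNIV. (sqrt (M $ i $ j / ?p i) * u $ i)\<^sup>2) =
        (\<Sum>i\<in>UNIV. M $ i $ j * (u $ i)\<^sup>2 / ?p i)"
      by (simp add: power_mult_distrib entry_nonneg row_marginal_nonneg)
    \<comment> \<open>The quotient is 1, or 0 when \<open>?q j = 0\<close>.\<close>
    also have "?q j / ?q j * \<dots> \<le> 1 * \<dots>"
      by (intro mult_right_mono sum_nonneg)
        (auto simp: entry_nonneg row_marginal_nonneg divide_le_eq_1)
    finally show ?thesis by simp
  qed
  have "(norm (transpose normalized *v u))\<^sup>2 = (\<Sum>j\<in>UNIV. ((transpose normalized *v u) $ j)\<^sup>2)"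
    by (rule power2_norm_vec)
  also have "\<dots> \<le> (\<Sum>j\<in>UNIV. \<Sum>i\<in>UNIV. M $ i $ j * (u $ i)\<^sup>2 / ?p i)"
    by (intro sum_mono bound)
  also have "\<dots> = (\<Sum>i\<in>UNIV. ?p i * (u $ i)\<^sup>2 / ?p i)"
    by (subst sum.swap) (simp add: row_marginal_def sum_distrib_right sum_divide_distrib)
  \<comment> \<open>Terms agree unless \<open>?p i = 0\<close>, where the left one is 0.\<close>
  also have "\<dots> \<le> (\<Sum>i\<in>UNIV. (u $ i)\<^sup>2)"
    by (intro sum_mono) simp
  also have "\<dots> = (norm u)\<^sup>2"
    by (rule power2_norm_vec[symmetric])
  finally show ?thesis
    by (simp add: power2_le_iff_abs_le)
qed

lemma sum_ratio_le_rank: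
  "(\<Sum>i\<in>UNIV. \<Sum>j\<in>UNIV. M $ i $ j * (M $ i $ j / (row_marginal M i * col_marginal M j)))
    \<le> real (rank M)"
proof -
  have "(\<Sum>i\<in>UNIV. \<Sum>j\<in>UNIV. M $ i $ j * (M $ i $ j / (row_marginal M i * col_marginal M j))) =
      (\<Sum>i\<in>UNIV. \<Sum>j\<in>UNIV. (normalized $ i $ j)\<^sup>2)"
    by (simp add: normalized_def power_mult_distrib power_divide row_marginal_nonneg
        col_marginal_nonneg power2_eq_square[of "M $ _ $ _"])
  also have "\<dots> \<le> real (rank normalized)"
    by (rule contraction_sum_squares_le_rank[OF normalized_contraction])
  also have "\<dots> \<le> real (rank M)"
    unfolding normalized_def by (simp only: of_nat_le_iff rank_scale_rows_columns_le)
  finally show ?thesis .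
qed

text \<open>Jensen's inequality, proved by bounding \<open>ln\<close> above by its tangent at \<open>R\<close>.\<close>

lemma mutual_info_le_log:
  assumes "0 < R"
    and "(\<Sum>i\<in>UNIV. \<Sum>j\<in>UNIV. M $ i $ j * (M $ i $ j / (row_marginal M i * col_marginal M j))) \<le> R"
  shows "mutual_info M \<le> log 2 R"
proof -
  let ?x = "\<lambda>i j. M $ i $ j / (row_marginal M i * col_marginal M j)"
  have "ln 2 * mutual_info M = (\<Sum>i\<in>UNIV. \<Sum>j\<in>UNIV. M $ i $ j * ln (?x i j))"
    by (simp add: mutual_info_def log_def sum_distrib_left)
  also have "\<dots> \<le> (\<Sum>i\<in>UNIV. \<Sum>j\<in>UNIV. (ln R - 1) * M $ i $ j + M $ i $ j * ?x i j / R)"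
  proof (intro sum_mono)
    fix i j
    show "M $ i $ j * ln (?x i j) \<le> (ln R - 1) * M $ i $ j + M $ i $ j * ?x i j / R"
    \<comment> \<open>For a zero entry both sides vanish; otherwise both marginals are positive, so
      the logarithm has a positive argument.\<close>
    proof (cases "M $ i $ j = 0")
      case False
      then have "0 < M $ i $ j"
        using entry_nonneg[of i j] by simp
      then have "0 < ?x i j"
        using entry_le_row_marginal[of i j] entry_le_col_marginal[of i j] by simp
      then have "ln (?x i j) \<le> ln R - 1 + ?x i j / R"
        using ln_le_minus_one[of "?x i j / R"] ln_divide_pos[of "?x i j" R] \<open>0 < R\<close>
        by (smt (verit) divide_pos_pos)
      then have "M $ i $ j * ln (?x i j) \<le> M $ i $ j * (ln R - 1 + ?x i j / R)"
        by (rule mult_left_mono[OF _ entry_nonneg])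
      then show ?thesis
        by (simp only: distrib_left mult.commute[of "ln R - 1"] times_divide_eq_right)
    qed simp
  qed
  also have "\<dots> = (ln R - 1) + (\<Sum>i\<in>UNIV. \<Sum>j\<in>UNIV. M $ i $ j * ?x i j) / R"
    by (simp only: sum.distrib sum_distrib_left[symmetric] sum_divide_distrib[symmetric]
        sum_entries mult_1_right)
  \<comment> \<open>The mean of \<open>?x\<close> is at most \<open>R\<close>, so the last quotient
    is at most 1.\<close>
  also have "\<dots> \<le> ln R"
    using assms by simp
  finally show ?thesis
    by (simp add: log_def field_simps)
qed

end

theorem theorem1:
  fixes M :: "real^'m^'n"
  assumes "joint_distribution M"
  shows "2 powr mutual_info M \<le> real (rank M)"
proof -
  \<comment> \<open>Total mass 1 forces positive rank, so \<open>rank M\<close> can serve as the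
    tangent point \<open>R\<close>.\<close>
  have "M \<noteq> 0"
    using sum_entries[OF assms] by auto
  then have "0 < real (rank M)"
    using rank_eq_0[of M] by simp
  moreover from this have "mutual_info M \<le> log 2 (real (rank M))"
    using mutual_info_le_log[OF assms] sum_ratio_le_rank[OF assms] by blast
  ultimately show ?thesis
    by (simp add: le_log_iff)
qed

end
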